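(* Let $g(x)=e^x/(1+e^x)$. For $n\ge k$ and $1\le i\le n$ let $Q_{n,i}(\lambda)=c_{n,i}+(d_{n,i}-c_{n,i})\,g[a_{n,i}(\lambda-b_{n,i})]$ be four-parameter logistic item response functions with latent trait $\Lambda\sim N(0,1)$ and real parameters $(a_{n,i},b_{n,i},c_{n,i},d_{n,i})$ satisfying $a_{n,i}\geq 0$ and $c_{n,i}<d_{n,i}$, $c_{n,i},d_{n,i}\in[0,1]$. Let $$P_{n,i}(\theta)=Q_{n,i}(\Phi^{-1}(\theta))=c_{n,i}+(d_{n,i}-c_{n,i})\,g\big[a_{n,i}(\Phi^{-1}(\theta)-b_{n,i})\big]$$ be the corresponding transformed item response functions with latent trait $\Theta=\Phi(\Lambda)\sim U(0,1)$. (i) If $a_{n,i}\neq 0$, then $\lim_{\theta\downarrow 0}P'_{n,i}(\theta)=\lim_{\theta\uparrow 1}P'_{n,i}(\theta)=+\infty$. (ii) Assume there exist constants $C_a,C_b,C_{c,d}>0$ independent of $(n,i)$ such that $a_{n,i}\in[1/C_a,C_a]$, $|b_{n,i}|\in[1/C_b,C_b]$, and $d_{n,i}-c_{n,i}\in[1/C_{c,d},C_{c,d}]$ for all $(n,i)$. Then $\{P_{n,i}\}$ satisfies Conditions 3 and 4 (stated in the context), the latter with $\kappa_{n,i}=c_{n,i}$ and $\gamma_{n,i}=d_{n,i}$.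
   Context: $\Phi$ is the cumulative distribution function of $N(0,1)$ and $\Phi^{-1}:(0,1)\to\mathbb{R}$ its inverse; the values $P_{n,i}(0),P_{n,i}(1)$ are understood as the limits of $P_{n,i}(\theta)$ as $\theta\downarrow0$, $\theta\uparrow1$. The indices range over a triangular array $n\ge k$, $1\le i\le n$, for a fixed integer $k\ge1$. Condition 3. For each $(n,i)$ the derivative $P'_{n,i}$ exists and is continuous on $(0,1)$. For all $0<\alpha<\beta<1$ there exist constants $m_{\alpha\beta},M_{\alpha\beta}$, not depending on $(n,i)$, such that $0<m_{\alpha\beta}<P'_{n,i}(\theta)<M_{\alpha\beta}<\infty$ for all $\theta\in[\alpha,\beta]$ and all $(n,i)$. Condition 4. For each $(n,i)$ there exist constants $\kappa_{n,i}<\gamma_{n,i}$ in $[0,1]$ such that $P_{n,i}(\theta)\in[\kappa_{n,i},\gamma_{n,i}]$ for all $\theta$. Moreover, for any $\epsilon>0$ there exist $l_\epsilon,u_\epsilon\in(0,1)$ (not depending on $(n,i)$) such that for all $(n,i)$, $$\sup_{\theta\in[0,l_\epsilon]}[P_{n,i}(\theta)-\kappa_{n,i}]\le\epsilon\quad\text{and}\quad\sup_{\theta\in[u_\epsilon,1]}[\gamma_{n,i}-P_{n,i}(\theta)]\le\epsilon .$$ *)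

theory Defs
  imports "HOL-Probability.Probability"
begin

definition std_normal_cdf :: "real \<Rightarrow> real" where
  "std_normal_cdf = cdf std_normal_distribution"

text \<open>Only meaningful on the open unit interval, the range of \<^const>\<open>std_normal_cdf\<close>.\<close>

definition std_normal_quantile :: "real \<Rightarrow> real" where
  "std_normal_quantile = the_inv_into UNIV std_normal_cdf"

definition logistic :: "real \<Rightarrow> real" where
  "logistic x = exp x / (1 + exp x)"

definition logistic_irf :: "real \<Rightarrow> real \<Rightarrow> real \<Rightarrow> real \<Rightarrow> real \<Rightarrow> real" where
  "logistic_irf a b c d x = c + (d - c) * logistic (a * (x - b))"

text \<open>A function on the open unit interval, with its values at 0 and 1 replaced by
  its one-sided limits there.\<close>

definition limit_extension :: "(real \<Rightarrow> real) \<Rightarrow> real \<Rightarrow> real" where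
  "limit_extension p \<theta> =
     (if \<theta> = 0 then Lim (at_right 0) p
      else if \<theta> = 1 then Lim (at_left 1) p
      else p \<theta>)"

text \<open>The arrays below are indexed by \<open>n \<ge> k\<close> and \<open>1 \<le> i \<le> n\<close>. Differentiability is asserted
  explicitly because \<^const>\<open>deriv\<close> is a total function, unspecified where no derivative exists.\<close>

definition derivative_condition :: "nat \<Rightarrow> (nat \<Rightarrow> nat \<Rightarrow> real \<Rightarrow> real) \<Rightarrow> bool" where
  "derivative_condition k P \<longleftrightarrow>
     (\<forall>n\<ge>k. \<forall>i\<in>{1..n}.
        (\<forall>\<theta>\<in>{0<..<1}. P n i differentiable at \<theta>) \<and>
        continuous_on {0<..<1} (deriv (P n i))) \<and>
     (\<forall>\<alpha> \<beta>. 0 < \<alpha> \<and> \<alpha> < \<beta> \<and> \<beta> < 1 \<longrightarrow>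
        (\<exists>m M. 0 < m \<and>
          (\<forall>n\<ge>k. \<forall>i\<in>{1..n}. \<forall>\<theta>\<in>{\<alpha>..\<beta>}.
             m < deriv (P n i) \<theta> \<and> deriv (P n i) \<theta> < M)))"

text \<open>The first two conjuncts of the first clause say that the endpoint values exist; the range
  constraint makes the suprema suprema of bounded nonempty sets, as needed for \<^const>\<open>Sup\<close> on
  the reals.\<close>

definition asymptote_condition ::
  "nat \<Rightarrow> (nat \<Rightarrow> nat \<Rightarrow> real \<Rightarrow> real) \<Rightarrow> (nat \<Rightarrow> nat \<Rightarrow> real) \<Rightarrow> (nat \<Rightarrow> nat \<Rightarrow> real) \<Rightarrow> bool" where
  "asymptote_condition k P \<kappa> \<gamma> \<longleftrightarrow>
     (\<forall>n\<ge>k. \<forall>i\<in>{1..n}.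
        (\<exists>l. (P n i \<longlongrightarrow> l) (at_right 0)) \<and>
        (\<exists>l. (P n i \<longlongrightarrow> l) (at_left 1)) \<and>
        \<kappa> n i \<in> {0..1} \<and> \<gamma> n i \<in> {0..1} \<and> \<kappa> n i < \<gamma> n i \<and>
        (\<forall>\<theta>\<in>{0..1}. limit_extension (P n i) \<theta> \<in> {\<kappa> n i..\<gamma> n i})) \<and>
     (\<forall>\<epsilon>>0. \<exists>l\<in>{0<..<1}. \<exists>u\<in>{0<..<1}. \<forall>n\<ge>k. \<forall>i\<in>{1..n}.
        (SUP \<theta>\<in>{0..l}. limit_extension (P n i) \<theta> - \<kappa> n i) \<le> \<epsilon> \<and>
        (SUP \<theta>\<in>{u..1}. \<gamma> n i - limit_extension (P n i) \<theta>) \<le> \<epsilon>)"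

end

(* By the chain rule P'(\<theta>) is the slope of the logistic curve at x = Phi^{-1}(\<theta>) divided by the
   normal density at x. The logistic slope decays only exponentially in \<bar>x\<bar>, whereas the density
   decays like exp (- x^2 / 2), so the quotient blows up at both ends. On a compact subinterval x
   is bounded, hence a (x - b) is bounded uniformly over the array. As x tends to +-infinity,
   a (x - b) does so uniformly over the array because a is bounded away from 0. *)
theory Submission
  imports Defs "HOL-Real_Asymp.Real_Asymp"
begin

section \<open>The standard normal cdf and its quantile function\<close>

lemma std_normal_cdf_diff:
  assumes "x \<le> y"
  shows "std_normal_cdf y - std_normal_cdf x = integral {x..y} std_normal_density"
proof (cases "x = y")
  case False
  interpret N: real_distribution std_normal_distribution
    by (rule real_dist_normal_dist)
  have int: "set_integrable lborel {x..y} std_normal_density"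
    unfolding set_integrable_def
    by (rule integrable_mult_indicator) (auto intro: integrable_normal_density)
  have "std_normal_cdf y - std_normal_cdf x = measure std_normal_distribution {x<..y}"
    unfolding std_normal_cdf_def using False assms by (intro N.cdf_diff_eq) auto
  also have "\<dots> = integral\<^sup>L std_normal_distribution (indicator {x<..y})"
    by simp
  also have "\<dots> = (\<integral>t. std_normal_density t * indicator {x<..y} t \<partial>lborel)"
    by (subst integral_density) (auto simp: normal_density_nonneg)
  \<comment> \<open>The half-open and the closed interval differ only in the null set {x}. The
    closed one is needed for the gauge integral, to which the fundamental theorem of calculus
    applies.\<close>
  also have "\<dots> = (LBINT t:{x..y}. std_normal_density t)"
    unfolding set_lebesgue_integral_def
    by (rule integral_cong_AE)
      (use AE_lborel_singleton[of x] in \<open>auto elim!: eventually_mono simp: indicator_def\<close>)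
  also have "\<dots> = integral {x..y} std_normal_density"
    using int by (rule set_borel_integral_eq_integral)
  finally show ?thesis .
qed simp

lemma std_normal_density_continuous_on: "continuous_on A std_normal_density"
  unfolding std_normal_density_def[abs_def] by (intro continuous_intros) auto

text \<open>Fundamental theorem of calculus: around x the cdf is a constant plus the integral of the
  density from x - 1. This base point lies strictly to the left of x, so the identity holds on a
  whole neighbourhood of x.\<close>

lemma std_normal_cdf_has_real_derivative:
  "(std_normal_cdf has_real_derivative std_normal_density x) (at x)"
proof -
  have "((\<lambda>t. integral {x - 1..t} std_normal_density) has_real_derivative std_normal_density x)
          (at x within {x - 1..x + 1})"
    by (rule integral_has_real_derivative[OF std_normal_density_continuous_on]) auto
  hence "((\<lambda>t. integral {x - 1..t} std_normal_density) has_real_derivative std_normal_density x) (at x)"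
    by (simp add: at_within_Icc_at)
  hence "((\<lambda>t. std_normal_cdf (x - 1) + integral {x - 1..t} std_normal_density)
           has_real_derivative std_normal_density x) (at x)"
    by (auto intro!: derivative_eq_intros)
  thus ?thesis
  proof (rule DERIV_cong_ev[OF refl _ refl, THEN iffD1, rotated])
    show "\<forall>\<^sub>F t in nhds x. std_normal_cdf (x - 1) + integral {x - 1..t} std_normal_density
            = std_normal_cdf t"
      by (rule eventually_mono[OF eventually_nhds_in_open[of "{x - 1<..}"]])
        (auto simp flip: std_normal_cdf_diff)
  qed
qed

lemma isCont_std_normal_cdf: "isCont std_normal_cdf x"
  using std_normal_cdf_has_real_derivative by (rule DERIV_isCont)

lemma strict_mono_std_normal_cdf: "strict_mono std_normal_cdf"
  using std_normal_cdf_has_real_derivative normal_density_pos[of 1 0]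
  by (intro strict_monoI) (metis DERIV_pos_imp_increasing zero_less_one)

lemma std_normal_cdf_less_iff [simp]: "std_normal_cdf x < std_normal_cdf y \<longleftrightarrow> x < y"
  using strict_mono_std_normal_cdf by (rule strict_mono_less)

lemma std_normal_cdf_at_bot: "(std_normal_cdf \<longlongrightarrow> 0) at_bot"
proof -
  interpret N: real_distribution std_normal_distribution
    by (rule real_dist_normal_dist)
  show ?thesis unfolding std_normal_cdf_def by (rule N.cdf_lim_at_bot)
qed

lemma std_normal_cdf_at_top: "(std_normal_cdf \<longlongrightarrow> 1) at_top"
proof -
  interpret N: real_distribution std_normal_distribution
    by (rule real_dist_normal_dist)
  show ?thesis unfolding std_normal_cdf_def by (rule N.cdf_lim_at_top_prob)
qed

text \<open>A cdf takes values in [0, 1]; comparing x with x - 1 and x + 1 by strict monotonicity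
  excludes both endpoints.\<close>

lemma std_normal_cdf_bounds: "std_normal_cdf x \<in> {0<..<1}"
proof -
  interpret N: real_distribution std_normal_distribution
    by (rule real_dist_normal_dist)
  have "0 \<le> std_normal_cdf (x - 1)" "std_normal_cdf (x + 1) \<le> 1"
    unfolding std_normal_cdf_def by (rule N.cdf_nonneg, rule N.cdf_bounded_prob)
  moreover have "std_normal_cdf (x - 1) < std_normal_cdf x" "std_normal_cdf x < std_normal_cdf (x + 1)"
    by simp_all
  ultimately show ?thesis
    by (auto simp del: std_normal_cdf_less_iff)
qed

text \<open>The limits 0 and 1 at the two infinities supply points with cdf below and above
  \<theta>; the intermediate value theorem does the rest.\<close>

lemma std_normal_cdf_surj:
  assumes "\<theta> \<in> {0<..<1}"
  obtains x where "std_normal_cdf x = \<theta>"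
proof -
  obtain u where u: "std_normal_cdf u < \<theta>"
    using order_tendstoD(2)[OF std_normal_cdf_at_bot, of \<theta>] assms
    by (auto simp: eventually_at_bot_linorder)
  obtain v where v: "\<theta> < std_normal_cdf v"
    using order_tendstoD(1)[OF std_normal_cdf_at_top, of \<theta>] assms
    by (auto simp: eventually_at_top_linorder)
  have "u \<le> v"
    using less_trans[OF u v] by simp
  with u v that show ?thesis
    using IVT[of std_normal_cdf u \<theta> v] isCont_std_normal_cdf by auto
qed

lemma std_normal_quantile_cdf [simp]: "std_normal_quantile (std_normal_cdf x) = x"
  unfolding std_normal_quantile_def
  by (rule the_inv_into_f_f) (auto intro: strict_mono_imp_inj_on strict_mono_std_normal_cdf)

lemma std_normal_cdf_quantile [simp]:
  "\<theta> \<in> {0<..<1} \<Longrightarrow> std_normal_cdf (std_normal_quantile \<theta>) = \<theta>"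
  by (erule std_normal_cdf_surj) auto

text \<open>This equivalence and the next one trade inequalities about the quantile for inequalities
  about the cdf. They yield the limits of the quantile at 0 and 1 and its bounds on
  subintervals.\<close>

lemma std_normal_quantile_less_iff:
  "\<theta> \<in> {0<..<1} \<Longrightarrow> std_normal_quantile \<theta> < x \<longleftrightarrow> \<theta> < std_normal_cdf x"
  by (metis std_normal_cdf_quantile std_normal_cdf_less_iff)

lemma less_std_normal_quantile_iff:
  "\<theta> \<in> {0<..<1} \<Longrightarrow> x < std_normal_quantile \<theta> \<longleftrightarrow> std_normal_cdf x < \<theta>"
  by (metis std_normal_cdf_quantile std_normal_cdf_less_iff)

lemma std_normal_quantile_has_real_derivative:
  assumes "\<theta> \<in> {0<..<1}"
  shows "(std_normal_quantile has_real_derivative inverse (std_normal_density (std_normal_quantile \<theta>)))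
           (at \<theta>)"
proof (rule DERIV_inverse_function[where f = std_normal_cdf and a = 0 and b = 1])
  \<comment> \<open>The inverse function rule presupposes continuity of the inverse. Since the
    quantile inverts the cdf on all of the real line, any radius around the preimage works, here
    1.\<close>
  have "isCont std_normal_quantile (std_normal_cdf (std_normal_quantile \<theta>))"
    by (rule isCont_inverse_function[of 1]) (auto intro: isCont_std_normal_cdf)
  thus "isCont std_normal_quantile \<theta>"
    using assms by simp
qed (use assms std_normal_cdf_has_real_derivative normal_density_pos[of 1 0] in
      \<open>auto simp: less_imp_neq[THEN not_sym]\<close>)

text \<open>For each x the interval from 0 to \<open>std_normal_cdf x\<close> is a right
  neighbourhood of 0 on which the quantile stays below x.\<close>

lemma filterlim_std_normal_quantile_at_bot: "filterlim std_normal_quantile at_bot (at_right 0)"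
  unfolding filterlim_at_bot_dense
proof
  fix x
  show "\<forall>\<^sub>F \<theta> in at_right 0. std_normal_quantile \<theta> < x"
    using eventually_at_right_real[of 0 "std_normal_cdf x"] std_normal_cdf_bounds[of x]
    by (auto elim!: eventually_mono simp: std_normal_quantile_less_iff)
qed

lemma filterlim_std_normal_quantile_at_top: "filterlim std_normal_quantile at_top (at_left 1)"
  unfolding filterlim_at_top_dense
proof
  fix x
  show "\<forall>\<^sub>F \<theta> in at_left 1. x < std_normal_quantile \<theta>"
    using eventually_at_left_real[of "std_normal_cdf x" 1] std_normal_cdf_bounds[of x]
    by (auto elim!: eventually_mono simp: less_std_normal_quantile_iff)
qed

section \<open>The logistic function: derivative, limits and slope bounds\<close>

lemma logistic_has_real_derivative:
  "(logistic has_real_derivative exp x / (1 + exp x)\<^sup>2) (at x)"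
  unfolding logistic_def[abs_def]
  by (rule derivative_eq_intros refl | simp add: add_pos_pos less_imp_neq[THEN not_sym])+
    (simp add: field_simps power2_eq_square)

lemma logistic_bounds: "0 < logistic x" "logistic x < 1"
  by (simp_all add: logistic_def add_pos_pos)

lemma logistic_at_bot: "(logistic \<longlongrightarrow> 0) at_bot"
  unfolding logistic_def[abs_def] by real_asymp

lemma logistic_at_top: "(logistic \<longlongrightarrow> 1) at_top"
  unfolding logistic_def[abs_def] by real_asymp

text \<open>Expanding the square already produces the summand 2 * exp x. The bound is crude, but it
  does not depend on the argument.\<close>

lemma logistic_deriv_le: "exp x / (1 + exp x)\<^sup>2 \<le> (1 :: real)"
proof -
  have "(1 + exp x)\<^sup>2 = 1 + 2 * exp x + (exp x)\<^sup>2"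
    by (simp add: power2_eq_square algebra_simps)
  hence "exp x \<le> (1 + exp x)\<^sup>2"
    using exp_gt_zero[of x] zero_le_power2[of "exp x"] by linarith
  thus ?thesis
    by (simp add: divide_le_eq_1)
qed

text \<open>Both summands of 1 + exp x are at most exp (max x 0), and x - 2 * max x 0 = -
  \<bar>x\<bar>. The bound depends on \<bar>x\<bar> alone, so a uniform bound on the argument gives
  a uniform lower bound on the slope.\<close>

lemma logistic_deriv_ge: "exp (- \<bar>x\<bar>) / 4 \<le> exp x / (1 + exp x)\<^sup>2" for x :: real
proof -
  have *: "1 + exp x \<le> 2 * exp (max x 0)"
    by (auto simp: max_def)
  have "(1 + exp x)\<^sup>2 \<le> (2 * exp (max x 0))\<^sup>2"
    by (rule power_mono[OF *]) (simp add: add_nonneg_nonneg)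
  hence "exp x / (2 * exp (max x 0))\<^sup>2 \<le> exp x / (1 + exp x)\<^sup>2"
    by (intro divide_left_mono mult_pos_pos zero_less_power add_pos_pos) auto
  moreover have "(2 * exp (max x 0))\<^sup>2 = 4 * exp (2 * max x 0)"
    by (simp add: power_mult_distrib flip: exp_double)
  moreover have "exp x / (4 * exp (2 * max x 0)) = exp (- \<bar>x\<bar>) / 4"
    by (simp add: field_simps max_def abs_if flip: exp_add)
  ultimately show ?thesis by (simp only:)
qed

section \<open>The slope of the transformed item response function\<close>

text \<open>The derivative is expressed in the variable \<open>x = std_normal_quantile \<theta>\<close>.\<close>

definition transformed_irf_slope :: "real \<Rightarrow> real \<Rightarrow> real \<Rightarrow> real \<Rightarrow> real \<Rightarrow> real" where
  "transformed_irf_slope a b c d x =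
     (d - c) * (a * (exp (a * (x - b)) / (1 + exp (a * (x - b)))\<^sup>2)) / std_normal_density x"

text \<open>Chain rule. The function \<open>p\<close> is specified only on the open unit interval,
  where the quantile is meaningful; openness suffices to transfer the derivative from the explicit
  composition to \<open>p\<close>.\<close>

lemma transformed_irf_has_real_derivative:
  assumes "\<theta> \<in> {0<..<1}"
    and p: "\<And>\<theta>. \<theta> \<in> {0<..<1} \<Longrightarrow> p \<theta> = logistic_irf a b c d (std_normal_quantile \<theta>)"
  shows "(p has_real_derivative transformed_irf_slope a b c d (std_normal_quantile \<theta>)) (at \<theta>)"
proof -
  have "((\<lambda>\<theta>. logistic_irf a b c d (std_normal_quantile \<theta>)) has_real_derivative
          transformed_irf_slope a b c d (std_normal_quantile \<theta>)) (at \<theta>)"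
    unfolding logistic_irf_def transformed_irf_slope_def
    by (rule derivative_eq_intros std_normal_quantile_has_real_derivative assms(1) refl
          DERIV_chain2[OF logistic_has_real_derivative])+
      (simp add: field_simps)
  thus ?thesis
    by (rule has_field_derivative_transform_within_open[where S = "{0<..<1}"])
      (use assms in auto)
qed

lemma transformed_irf_slope_tail:
  assumes "a > 0" "c < d"
  shows "filterlim (transformed_irf_slope a b c d) at_top at_bot"
    and "filterlim (transformed_irf_slope a b c d) at_top at_top"
proof -
  \<comment> \<open>Naming the gap makes d - c a single parameter of known sign for the asymptotic
    expansion.\<close>
  define s where "s = d - c"
  have "s > 0" using assms by (simp add: s_def)
  with \<open>a > 0\<close> show "filterlim (transformed_irf_slope a b c d) at_top at_bot"
    "filterlim (transformed_irf_slope a b c d) at_top at_top"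
    unfolding transformed_irf_slope_def[abs_def] std_normal_density_def s_def[symmetric]
    by real_asymp+
qed

lemma continuous_on_transformed_irf_slope: "continuous_on A (transformed_irf_slope a b c d)"
proof -
  have "1 + exp t \<noteq> 0" for t :: real
    using exp_gt_zero[of t] by linarith
  thus ?thesis
    unfolding transformed_irf_slope_def[abs_def] using normal_density_pos[of 1 0]
    by (intro continuous_intros std_normal_density_continuous_on)
      (auto simp: less_imp_neq[THEN not_sym])
qed

text \<open>The logistic argument is at most A * (R + B) in absolute value, and for \<bar>x\<bar>
  \<le> R the density lies between its values at R and at 0. The lower bound combines the smallest
  numerator with the largest density, the upper bound the reverse, with 1 bounding the logistic
  slope.\<close>

lemma transformed_irf_slope_bounds:
  assumes a: "a \<in> {1 / A..A}" and b: "\<bar>b\<bar> \<le> B" and s: "d - c \<in> {1 / S..S}"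
    and pos: "A > 0" "S > 0" and x: "\<bar>x\<bar> \<le> R"
  shows "exp (- (A * (R + B))) / 4 / (A * S) / std_normal_density 0 \<le> transformed_irf_slope a b c d x"
    and "transformed_irf_slope a b c d x \<le> A * S / std_normal_density R"
proof -
  define y where "y = a * (x - b)"
  define L where "L = exp y / (1 + exp y)\<^sup>2"
  have inv: "0 < 1 / A" "0 < 1 / S" using pos by auto
  have a0: "a > 0" and s0: "d - c > 0"
    using inv a s unfolding atLeastAtMost_iff by linarith+
  have "\<bar>y\<bar> \<le> A * (R + B)"
    unfolding y_def abs_mult using a a0 b x by (intro mult_mono) auto
  hence "exp (- (A * (R + B))) / 4 \<le> exp (- \<bar>y\<bar>) / 4" by simp
  also have "\<dots> \<le> L" unfolding L_def by (rule logistic_deriv_ge)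
  finally have L1: "exp (- (A * (R + B))) / 4 \<le> L" .
  have L2: "L \<le> 1" unfolding L_def by (rule logistic_deriv_le)
  have L0: "0 \<le> L" by (simp add: L_def)
  have sq: "x\<^sup>2 \<le> R\<^sup>2"
    using x by (simp add: abs_le_square_iff[symmetric])
  have \<phi>: "std_normal_density x \<le> std_normal_density 0" "std_normal_density R \<le> std_normal_density x"
    using sq by (auto simp: std_normal_density_def divide_right_mono)
  have \<phi>0: "std_normal_density t > 0" for t by (rule normal_density_pos) simp
  have eq: "transformed_irf_slope a b c d x = (d - c) * (a * L) / std_normal_density x"
    by (simp add: transformed_irf_slope_def L_def y_def)
  have "(1 / S) * ((1 / A) * (exp (- (A * (R + B))) / 4)) \<le> (d - c) * (a * L)"
    using a s L0 L1
    by (intro mult_mono mult_nonneg_nonneg less_imp_le[OF a0] less_imp_le[OF s0]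
          less_imp_le[OF inv(1)] less_imp_le[OF inv(2)]) auto
  hence "(1 / S) * ((1 / A) * (exp (- (A * (R + B))) / 4)) / std_normal_density 0
      \<le> (d - c) * (a * L) / std_normal_density x"
    using \<phi> \<phi>0 a0 s0 L0 by (intro frac_le) auto
  thus "exp (- (A * (R + B))) / 4 / (A * S) / std_normal_density 0 \<le> transformed_irf_slope a b c d x"
    by (simp add: eq mult_ac)
  have "(d - c) * (a * L) \<le> S * (A * 1)"
    using a s a0 s0 pos L0 L2 by (intro mult_mono mult_nonneg_nonneg) auto
  hence "(d - c) * (a * L) / std_normal_density x \<le> S * (A * 1) / std_normal_density R"
    using \<phi> \<phi>0 pos by (intro frac_le) auto
  thus "transformed_irf_slope a b c d x \<le> A * S / std_normal_density R"
    by (simp add: eq mult_ac)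
qed

section \<open>Limits, range and uniform tails of the item response functions\<close>

lemma logistic_irf_at_bot:
  assumes "a > 0"
  shows "(logistic_irf a b c d \<longlongrightarrow> c) at_bot"
proof -
  have "filterlim (\<lambda>x. a * (x - b)) at_bot at_bot"
    using assms by real_asymp
  from filterlim_compose[OF logistic_at_bot this]
  have "((\<lambda>x. c + (d - c) * logistic (a * (x - b))) \<longlongrightarrow> c + (d - c) * 0) at_bot"
    by (intro tendsto_intros)
  thus ?thesis by (simp add: logistic_irf_def[abs_def])
qed

lemma logistic_irf_at_top:
  assumes "a > 0"
  shows "(logistic_irf a b c d \<longlongrightarrow> d) at_top"
proof -
  have "filterlim (\<lambda>x. a * (x - b)) at_top at_top"
    using assms by real_asymp
  from filterlim_compose[OF logistic_at_top this]
  have "((\<lambda>x. c + (d - c) * logistic (a * (x - b))) \<longlongrightarrow> c + (d - c) * 1) at_top"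
    by (intro tendsto_intros)
  thus ?thesis by (simp add: logistic_irf_def[abs_def])
qed

lemma logistic_irf_in_range:
  assumes "c < d"
  shows "logistic_irf a b c d x \<in> {c..d}"
proof -
  have "(d - c) * logistic t \<le> (d - c) * 1" "0 \<le> (d - c) * logistic t" for t
    using assms logistic_bounds[of t] by (auto intro!: mult_left_mono mult_nonneg_nonneg)
  from this[of "a * (x - b)"] show ?thesis by (simp add: logistic_irf_def)
qed

lemma logistic_uniform_lower_tail:
  assumes "A > 0" "\<epsilon> > 0"
  obtains X where "\<And>a b x. a \<ge> 1 / A \<Longrightarrow> \<bar>b\<bar> \<le> B \<Longrightarrow> x \<le> X \<Longrightarrow> logistic (a * (x - b)) \<le> \<epsilon>"
proof -
  obtain t where t: "\<And>y. y \<le> t \<Longrightarrow> logistic y < \<epsilon>"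
    using order_tendstoD(2)[OF logistic_at_bot \<open>\<epsilon> > 0\<close>] by (auto simp: eventually_at_bot_linorder)
  show ?thesis
  \<comment> \<open>Below this threshold b - x is at least A * \<bar>t\<bar> whenever \<bar>b\<bar>
    \<le> B; multiplying by a \<ge> 1 / A leaves at least \<bar>t\<bar>, so the logistic argument
    falls below t.\<close>
  proof (rule that[of "- (A * \<bar>t\<bar>) - B"])
    fix a b x :: real
    assume *: "a \<ge> 1 / A" "\<bar>b\<bar> \<le> B" "x \<le> - (A * \<bar>t\<bar>) - B"
    have "(1 / A) * (A * \<bar>t\<bar>) \<le> a * (b - x)"
    proof (rule mult_mono)
      have "0 < 1 / A" using assms by simp
      thus "0 \<le> a" using * by linarith
    qed (use * assms in auto)
    hence "\<bar>t\<bar> \<le> a * (b - x)" using assms by simp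
    hence "a * (x - b) \<le> t" by (simp add: algebra_simps)
    thus "logistic (a * (x - b)) \<le> \<epsilon>" using t[of "a * (x - b)"] by simp
  qed
qed

lemma logistic_minus: "logistic (- x) = 1 - logistic x"
proof -
  have "1 + exp x \<noteq> 0" using exp_gt_zero[of x] by linarith
  thus ?thesis by (simp add: logistic_def exp_minus field_simps)
qed

text \<open>The reflection of x and b to - x and - b preserves \<bar>b\<bar> \<le> B and negates the
  logistic argument, so \<open>logistic_minus\<close> reduces this to the lower tail.\<close>

lemma logistic_uniform_upper_tail:
  assumes "A > 0" "\<epsilon> > 0"
  obtains X where "\<And>a b x. a \<ge> 1 / A \<Longrightarrow> \<bar>b\<bar> \<le> B \<Longrightarrow> x \<ge> X \<Longrightarrow> 1 - logistic (a * (x - b)) \<le> \<epsilon>"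
proof -
  obtain X where X: "\<And>a b x. a \<ge> 1 / A \<Longrightarrow> \<bar>b\<bar> \<le> B \<Longrightarrow> x \<le> X \<Longrightarrow> logistic (a * (x - b)) \<le> \<epsilon>"
    using logistic_uniform_lower_tail[OF assms, of B] by blast
  show ?thesis
  proof (rule that[of "- X"])
    fix a b x :: real
    assume "a \<ge> 1 / A" "\<bar>b\<bar> \<le> B" "x \<ge> - X"
    from X[OF this(1), of "- b" "- x"] this
    show "1 - logistic (a * (x - b)) \<le> \<epsilon>"
      by (simp add: logistic_minus[symmetric] algebra_simps)
  qed
qed

section \<open>Endpoint slopes and Conditions 3 and 4 for the array\<close>

theorem proposition2:
  fixes k :: nat
    and a b c d :: "nat \<Rightarrow> nat \<Rightarrow> real"
    and Q P :: "nat \<Rightarrow> nat \<Rightarrow> real \<Rightarrow> real"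
  assumes k: "1 \<le> k"
    and a_nonneg: "\<And>n i. n \<ge> k \<Longrightarrow> i \<in> {1..n} \<Longrightarrow> a n i \<ge> 0"
    and c_range: "\<And>n i. n \<ge> k \<Longrightarrow> i \<in> {1..n} \<Longrightarrow> c n i \<in> {0..1}"
    and d_range: "\<And>n i. n \<ge> k \<Longrightarrow> i \<in> {1..n} \<Longrightarrow> d n i \<in> {0..1}"
    and c_less_d: "\<And>n i. n \<ge> k \<Longrightarrow> i \<in> {1..n} \<Longrightarrow> c n i < d n i"
    and Q: "\<And>n i x. n \<ge> k \<Longrightarrow> i \<in> {1..n} \<Longrightarrow>
              Q n i x = logistic_irf (a n i) (b n i) (c n i) (d n i) x"
    and P: "\<And>n i \<theta>. n \<ge> k \<Longrightarrow> i \<in> {1..n} \<Longrightarrow> \<theta> \<in> {0<..<1} \<Longrightarrow>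
              P n i \<theta> = Q n i (std_normal_quantile \<theta>)"
  shows "(\<forall>n\<ge>k. \<forall>i\<in>{1..n}. a n i \<noteq> 0 \<longrightarrow>
            (\<forall>\<theta>\<in>{0<..<1}. P n i differentiable at \<theta>) \<and>
            filterlim (deriv (P n i)) at_top (at_right 0) \<and>
            filterlim (deriv (P n i)) at_top (at_left 1)) \<and>
         ((\<exists>C\<^sub>a>0. \<exists>C\<^sub>b>0. \<exists>C\<^sub>c\<^sub>d>0. \<forall>n\<ge>k. \<forall>i\<in>{1..n}.
             a n i \<in> {1 / C\<^sub>a..C\<^sub>a} \<and>
             \<bar>b n i\<bar> \<in> {1 / C\<^sub>b..C\<^sub>b} \<and>
             d n i - c n i \<in> {1 / C\<^sub>c\<^sub>d..C\<^sub>c\<^sub>d}) \<longrightarrow>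
          derivative_condition k P \<and> asymptote_condition k P c d)"
proof -
  have P': "P n i \<theta> = logistic_irf (a n i) (b n i) (c n i) (d n i) (std_normal_quantile \<theta>)"
    if "n \<ge> k" "i \<in> {1..n}" "\<theta> \<in> {0<..<1}" for n i \<theta>
    using P[OF that] Q[OF that(1,2)] by simp
  define D where "D n i = transformed_irf_slope (a n i) (b n i) (c n i) (d n i)" for n i
  have der: "(P n i has_real_derivative D n i (std_normal_quantile \<theta>)) (at \<theta>)"
    if "n \<ge> k" "i \<in> {1..n}" "\<theta> \<in> {0<..<1}" for n i \<theta>
    unfolding D_def using transformed_irf_has_real_derivative[OF that(3) P'] that by blast
  have deriv: "deriv (P n i) \<theta> = D n i (std_normal_quantile \<theta>)"
    if "n \<ge> k" "i \<in> {1..n}" "\<theta> \<in> {0<..<1}" for n i \<theta>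
    using der[OF that] by (rule DERIV_imp_deriv)
  have diff: "P n i differentiable at \<theta>"
    if "n \<ge> k" "i \<in> {1..n}" "\<theta> \<in> {0<..<1}" for n i \<theta>
    using der[OF that] real_differentiable_def by blast
  \<comment> \<open>One-sided limits at 0 and 1 see only points of the open unit interval, where the
    formulas for \<open>P\<close> and its derivative hold.\<close>
  have near0: "\<forall>\<^sub>F \<theta> in at_right 0. \<theta> \<in> {0<..<1 :: real}"
    by (rule eventually_at_right_real) simp
  have near1: "\<forall>\<^sub>F \<theta> in at_left 1. \<theta> \<in> {0<..<1 :: real}"
    by (rule eventually_at_left_real) simp
  show ?thesis
  proof (rule conjI, goal_cases)
    case 1
    show ?case
    proof (intro allI impI ballI conjI)
      fix n i assume ni: "n \<ge> k" "i \<in> {1..n}" and "a n i \<noteq> 0"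
      have a: "a n i > 0" using a_nonneg[OF ni] \<open>a n i \<noteq> 0\<close> by simp
      note tail = transformed_irf_slope_tail[OF a c_less_d[OF ni], of "b n i", folded D_def]
      show "filterlim (deriv (P n i)) at_top (at_right 0)"
        using filterlim_compose[OF tail(1) filterlim_std_normal_quantile_at_bot]
        by (rule filterlim_mono_eventually)
          (use near0 in \<open>auto elim!: eventually_mono simp: deriv[OF ni]\<close>)
      show "filterlim (deriv (P n i)) at_top (at_left 1)"
        using filterlim_compose[OF tail(2) filterlim_std_normal_quantile_at_top]
        by (rule filterlim_mono_eventually)
          (use near1 in \<open>auto elim!: eventually_mono simp: deriv[OF ni]\<close>)
    qed (use diff in blast)
  next
    case 2
    show ?case
    proof
      assume "\<exists>C\<^sub>a>0. \<exists>C\<^sub>b>0. \<exists>C\<^sub>c\<^sub>d>0. \<forall>n\<ge>k. \<forall>i\<in>{1..n}.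
        a n i \<in> {1 / C\<^sub>a..C\<^sub>a} \<and> \<bar>b n i\<bar> \<in> {1 / C\<^sub>b..C\<^sub>b} \<and> d n i - c n i \<in> {1 / C\<^sub>c\<^sub>d..C\<^sub>c\<^sub>d}"
      then obtain A B S where pos: "A > 0" "B > 0" "S > 0"
        and bounds: "\<And>n i. n \<ge> k \<Longrightarrow> i \<in> {1..n} \<Longrightarrow>
          a n i \<in> {1 / A..A} \<and> \<bar>b n i\<bar> \<in> {1 / B..B} \<and> d n i - c n i \<in> {1 / S..S}"
        by metis
      have a: "a n i \<in> {1 / A..A}" and b: "\<bar>b n i\<bar> \<le> B" and s: "d n i - c n i \<in> {1 / S..S}"
        if "n \<ge> k" "i \<in> {1..n}" for n i
        using bounds[OF that] by auto
      have a_pos: "a n i > 0" if "n \<ge> k" "i \<in> {1..n}" for n i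
      proof -
        have "0 < 1 / A" using pos by simp
        thus ?thesis using a[OF that] unfolding atLeastAtMost_iff by linarith
      qed
      have "derivative_condition k P"
        unfolding derivative_condition_def
      proof (intro conjI allI impI ballI)
        fix n i assume ni: "n \<ge> k" "i \<in> {1..n}"
        have "continuous_on {0<..<1} (D n i \<circ> std_normal_quantile)"
          unfolding D_def
          by (intro continuous_on_compose continuous_on_transformed_irf_slope
                DERIV_continuous_on[OF DERIV_subset[OF std_normal_quantile_has_real_derivative]]) auto
        thus "continuous_on {0<..<1} (deriv (P n i))"
          by (rule continuous_on_eq) (auto simp: deriv[OF ni])
      next
        fix \<alpha> \<beta> :: real assume \<alpha>\<beta>: "0 < \<alpha> \<and> \<alpha> < \<beta> \<and> \<beta> < 1"
        \<comment> \<open>The quantile is increasing, so on [\<alpha>, \<beta>] it stays between its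
          two endpoint values and hence within [-R, R]. This R does not depend on n and i.\<close>
        define R where "R = max \<bar>std_normal_quantile \<alpha>\<bar> \<bar>std_normal_quantile \<beta>\<bar>"
        define m where "m = exp (- (A * (R + B))) / 4 / (A * S) / std_normal_density 0"
        define M where "M = A * S / std_normal_density R"
        have "m > 0"
          unfolding m_def using pos normal_density_pos[of 1 0 0] by simp
        have mM: "m \<le> deriv (P n i) \<theta> \<and> deriv (P n i) \<theta> \<le> M"
          if ni: "n \<ge> k" "i \<in> {1..n}" and \<theta>: "\<theta> \<in> {\<alpha>..\<beta>}" for n i \<theta>
        proof -
          have "\<theta> \<in> {0<..<1}" using \<theta> \<alpha>\<beta> by auto
          moreover from this have "\<not> std_normal_quantile \<theta> < std_normal_quantile \<alpha>"
              "\<not> std_normal_quantile \<beta> < std_normal_quantile \<theta>"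
            using \<theta> \<alpha>\<beta> by (simp_all add: std_normal_quantile_less_iff less_std_normal_quantile_iff)
          hence "\<bar>std_normal_quantile \<theta>\<bar> \<le> R" unfolding R_def by linarith
          ultimately show ?thesis
            unfolding m_def M_def using transformed_irf_slope_bounds[OF a[OF ni] b[OF ni] s[OF ni] pos(1,3)]
            by (simp add: deriv[OF ni] D_def)
        qed
        show "\<exists>m M. 0 < m \<and> (\<forall>n\<ge>k. \<forall>i\<in>{1..n}. \<forall>\<theta>\<in>{\<alpha>..\<beta>}.
            m < deriv (P n i) \<theta> \<and> deriv (P n i) \<theta> < M)"
        \<comment> \<open>The slope bounds are weak inequalities; the witnesses m / 2 and M + 1 make
          them strict.\<close>
        proof (intro exI conjI allI impI ballI)
          fix n i \<theta> assume "n \<ge> k" "i \<in> {1..n}" "\<theta> \<in> {\<alpha>..\<beta>}"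
          from mM[OF this] \<open>m > 0\<close> show "m / 2 < deriv (P n i) \<theta>" "deriv (P n i) \<theta> < M + 1"
            by linarith+
        qed (use \<open>m > 0\<close> in simp)
      qed (use diff in blast)
      moreover have "asymptote_condition k P c d"
      proof -
        have lim0: "(P n i \<longlongrightarrow> c n i) (at_right 0)" if ni: "n \<ge> k" "i \<in> {1..n}" for n i
          using filterlim_compose[OF logistic_irf_at_bot[OF a_pos[OF ni]] filterlim_std_normal_quantile_at_bot]
          by (rule Lim_transform_eventually)
            (use near0 in \<open>auto elim!: eventually_mono simp: P'[OF ni]\<close>)
        have lim1: "(P n i \<longlongrightarrow> d n i) (at_left 1)" if ni: "n \<ge> k" "i \<in> {1..n}" for n i
          using filterlim_compose[OF logistic_irf_at_top[OF a_pos[OF ni]] filterlim_std_normal_quantile_at_top]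
          by (rule Lim_transform_eventually)
            (use near1 in \<open>auto elim!: eventually_mono simp: P'[OF ni]\<close>)
        have ext0: "limit_extension (P n i) 0 = c n i" if "n \<ge> k" "i \<in> {1..n}" for n i
          using tendsto_Lim[OF _ lim0[OF that]] by (simp add: limit_extension_def)
        have ext1: "limit_extension (P n i) 1 = d n i" if "n \<ge> k" "i \<in> {1..n}" for n i
          using tendsto_Lim[OF _ lim1[OF that]] by (simp add: limit_extension_def)
        have ext: "limit_extension (P n i) \<theta> =
            logistic_irf (a n i) (b n i) (c n i) (d n i) (std_normal_quantile \<theta>)"
          if "n \<ge> k" "i \<in> {1..n}" "\<theta> \<in> {0<..<1}" for n i \<theta>
          using P'[OF that] that by (simp add: limit_extension_def)
        \<comment> \<open>Since c and d lie in [0, 1], the gap d - c is at most 1, so a logistic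
          tail within \<epsilon> leaves the response function within \<epsilon> of its
          asymptote.\<close>
        have scale: "(d n i - c n i) * t \<le> \<epsilon>"
          if "n \<ge> k" "i \<in> {1..n}" "t \<le> \<epsilon>" "0 \<le> \<epsilon>" for n i t \<epsilon>
        proof -
          have "(d n i - c n i) * t \<le> (d n i - c n i) * \<epsilon>"
            using c_less_d[OF that(1,2)] that by (intro mult_left_mono) auto
          also have "\<dots> \<le> 1 * \<epsilon>"
            using c_range[OF that(1,2)] d_range[OF that(1,2)] that by (intro mult_right_mono) auto
          finally show ?thesis by simp
        qed
        show ?thesis
          unfolding asymptote_condition_def
        proof (intro conjI allI impI ballI)
          fix n i \<theta> assume ni: "n \<ge> k" "i \<in> {1..n}" and "\<theta> \<in> {0..1 :: real}"
          then consider "\<theta> = 0" | "\<theta> = 1" | "\<theta> \<in> {0<..<1}" by fastforce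
          thus "limit_extension (P n i) \<theta> \<in> {c n i..d n i}"
            by cases (use c_less_d[OF ni] logistic_irf_in_range in \<open>auto simp: ext0[OF ni] ext1[OF ni] ext[OF ni]\<close>)
        next
          fix \<epsilon> :: real assume \<epsilon>: "\<epsilon> > 0"
          obtain X where X: "\<And>a b x. a \<ge> 1 / A \<Longrightarrow> \<bar>b\<bar> \<le> B \<Longrightarrow> x \<le> X \<Longrightarrow> logistic (a * (x - b)) \<le> \<epsilon>"
            using logistic_uniform_lower_tail[OF pos(1) \<epsilon>, of B] by blast
          obtain Y where Y: "\<And>a b x. a \<ge> 1 / A \<Longrightarrow> \<bar>b\<bar> \<le> B \<Longrightarrow> x \<ge> Y \<Longrightarrow> 1 - logistic (a * (x - b)) \<le> \<epsilon>"
            using logistic_uniform_upper_tail[OF pos(1) \<epsilon>, of B] by blast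
          \<comment> \<open>The cutoff l is the cdf at the uniform threshold X: up to it the
            quantile is at most X. A pointwise bound on the nonempty interval then bounds the
            supremum.\<close>
          have "(SUP \<theta>\<in>{0..std_normal_cdf X}. limit_extension (P n i) \<theta> - c n i) \<le> \<epsilon>"
            if ni: "n \<ge> k" "i \<in> {1..n}" for n i
          proof (rule cSUP_least)
            fix \<theta> assume \<theta>: "\<theta> \<in> {0..std_normal_cdf X}"
            show "limit_extension (P n i) \<theta> - c n i \<le> \<epsilon>"
            \<comment> \<open>At 0 the quantile carries no information; there the extension equals
              its limit c and the difference vanishes.\<close>
            proof (cases "\<theta> = 0")
              case True
              thus ?thesis using \<epsilon> by (simp add: ext0[OF ni])
            next
              case False
              hence \<theta>': "\<theta> \<in> {0<..<1}" using \<theta> std_normal_cdf_bounds[of X] by auto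
              hence "std_normal_quantile \<theta> \<le> X"
                using \<theta> less_std_normal_quantile_iff[OF \<theta>', of X] by auto
              from scale[OF ni X[OF _ b[OF ni] this, of "a n i"]] a[OF ni] \<epsilon>
              show ?thesis by (simp add: ext[OF ni \<theta>'] logistic_irf_def)
            qed
          qed (use std_normal_cdf_bounds[of X] in auto)
          moreover have "(SUP \<theta>\<in>{std_normal_cdf Y..1}. d n i - limit_extension (P n i) \<theta>) \<le> \<epsilon>"
            if ni: "n \<ge> k" "i \<in> {1..n}" for n i
          proof (rule cSUP_least)
            fix \<theta> assume \<theta>: "\<theta> \<in> {std_normal_cdf Y..1}"
            show "d n i - limit_extension (P n i) \<theta> \<le> \<epsilon>"
            proof (cases "\<theta> = 1")
              case True
              thus ?thesis using \<epsilon> by (simp add: ext1[OF ni])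
            next
              case False
              hence \<theta>': "\<theta> \<in> {0<..<1}" using \<theta> std_normal_cdf_bounds[of Y] by auto
              hence "Y \<le> std_normal_quantile \<theta>"
                using \<theta> std_normal_quantile_less_iff[OF \<theta>', of Y] by auto
              \<comment> \<open>The upper gap d - P equals (d - c) * (1 - logistic), so
                \<open>scale\<close> applies with t the complementary logistic value.\<close>
              from scale[OF ni Y[OF _ b[OF ni] this, of "a n i"]] a[OF ni] \<epsilon>
              show ?thesis by (simp add: ext[OF ni \<theta>'] logistic_irf_def algebra_simps)
            qed
          qed (use std_normal_cdf_bounds[of Y] in auto)
          ultimately show "\<exists>l\<in>{0<..<1}. \<exists>u\<in>{0<..<1}. \<forall>n\<ge>k. \<forall>i\<in>{1..n}.
              (SUP \<theta>\<in>{0..l}. limit_extension (P n i) \<theta> - c n i) \<le> \<epsilon> \<and>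
              (SUP \<theta>\<in>{u..1}. d n i - limit_extension (P n i) \<theta>) \<le> \<epsilon>"
            by (intro bexI[of _ "std_normal_cdf X"] bexI[of _ "std_normal_cdf Y"] std_normal_cdf_bounds)
              simp
        next
          fix n i assume ni: "n \<ge> k" "i \<in> {1..n}"
          show "\<exists>l. (P n i \<longlongrightarrow> l) (at_right 0)" "\<exists>l. (P n i \<longlongrightarrow> l) (at_left 1)"
            using lim0[OF ni] lim1[OF ni] by blast+
          show "c n i \<in> {0..1}" "d n i \<in> {0..1}" "c n i < d n i"
            by (rule c_range d_range c_less_d; fact ni)+
        qed
      qed
      ultimately show "derivative_condition k P \<and> asymptote_condition k P c d" ..
    qed
  qed
qed

end
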